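(* Let $0<p<1$, $q=1-p$, let $N$ be a positive integer with $Np\in\mathbb Z$ and $1\le Np\le N-1$, and let $X\sim\operatorname{Bin}(N,p)$. For $j\ge1$ put $$a_{2j-1}(0;p)=\frac{B_{2j}}{(2j-1)\,2j}\Bigl[1-\bigl(p^{1-2j}+q^{1-2j}\bigr)\Bigr],$$ and for $M\ge0$ put $$T_M:=\sum_{j=1}^{M}\frac{a_{2j-1}(0;p)}{N^{2j-1}}.$$ Then for every $M\ge0$ $$(-1)^{M+1}\Bigl[\log\frac{\mathbb E|X-Np|}{\sqrt{2Npq/\pi}}-T_M\Bigr]>0,$$ which is the sign of the first omitted term $a_{2M+1}(0;p)/N^{2M+1}$. Consequently the logarithm $\log\frac{\mathbb E|X-Np|}{\sqrt{2Npq/\pi}}$ lies strictly between any two consecutive partial sums $T_M$, $T_{M+1}$; in particular, for all such $N$, $$\sqrt{\frac{2Npq}{\pi}}\;e^{\,a_1(0;p)/N}<\mathbb E|X-Np|<\sqrt{\frac{2Npq}{\pi}}\;e^{\,a_1(0;p)/N+a_3(0;p)/N^{3}}.$$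
   Context: $B_k$ are the Bernoulli numbers, $\frac{z}{e^z-1}=\sum_{k\ge0}B_k\frac{z^k}{k!}$. $\operatorname{Bin}(N,p)$ is the binomial distribution. An empty sum is $0$, so $T_0=0$. *)

theory Defs
  imports "HOL-Probability.Probability" "HOL-Computational_Algebra.Formal_Power_Series"
begin

text \<open>
  Bernoulli numbers, from the exponential generating function
  \<open>z / (e^z - 1)\<close>. Both numerator and denominator have subdegree 1, so the quotient of
  formal power series is a genuine one (see \<open>bernoulli_number_egf\<close>).
\<close>

definition bernoulli_number :: "nat \<Rightarrow> real" where
  "bernoulli_number k = fact k * fps_nth (fps_X / (fps_exp 1 - 1)) k"

lemma bernoulli_number_egf:
  "Abs_fps (\<lambda>k. bernoulli_number k / fact k) * (fps_exp 1 - 1) = fps_X"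
proof -
  have nz: "fps_exp (1::real) - 1 \<noteq> 0"
  proof
    assume "fps_exp (1::real) - 1 = 0"
    then have "fps_nth (fps_exp (1::real) - 1) 1 = 0" by simp
    then show False by simp
  qed
  have "subdegree (fps_exp (1::real) - 1) = 1"
    by (rule subdegreeI) simp_all
  then have "(fps_exp (1::real) - 1) dvd fps_X"
    using nz by (simp add: fps_dvd_iff)
  moreover have "Abs_fps (\<lambda>k. bernoulli_number k / fact k) = fps_X / (fps_exp 1 - 1)"
    by (simp add: bernoulli_number_def fps_eq_iff)
  ultimately show ?thesis
    by simp
qed

text \<open>
  \<open>a_coeff p j\<close> is $a_{2j-1}(0;p)$, for \<open>j \<ge> 1\<close>; it is indexed by \<open>j\<close>, not by \<open>2j - 1\<close>.
\<close>

definition a_coeff :: "real \<Rightarrow> nat \<Rightarrow> real" where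
  "a_coeff p j =
     bernoulli_number (2 * j) / ((2 * real j - 1) * (2 * real j)) *
       (1 - (p powi (1 - 2 * int j) + (1 - p) powi (1 - 2 * int j)))"

definition T_sum :: "real \<Rightarrow> nat \<Rightarrow> nat \<Rightarrow> real" where
  "T_sum p N M = (\<Sum>j = 1..M. a_coeff p j / real N ^ (2 * j - 1))"

end

theory Submission
  imports Defs "HOL-Real_Asymp.Real_Asymp"
begin

text \<open>
  With \<open>m = Np\<close> and \<open>n = Nq\<close>, de Moivre's closed form of the mean absolute deviation is
  \<open>2 q m (N choose m) p^m q^n\<close>. Inserting Stirling's formula for the three factorials, the logarithm
  of its quotient by \<open>sqrt (2 N p q / pi)\<close> minus \<open>T_M\<close> is
  \<open>\<rho>(N) - \<rho>(m) - \<rho>(n)\<close>, where \<open>\<rho>\<close> is the remainder of Stirling's series after \<open>M\<close> terms. On the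
  positive integers \<open>(-1)^M \<rho>\<close> is strictly decreasing with limit 0, hence positive, so the sign
  follows from \<open>m < N\<close>. Monotonicity is one step of Euler--Maclaurin summation for
  the logarithm: its error is governed by \<open>B_{2M+2}(u) - B_{2M+2}\<close>, which has constant sign on \<open>(0,1)\<close>.
  The sign of the first omitted term then follows by comparing the results for \<open>M\<close> and \<open>M + 1\<close>.
\<close>

section \<open>Bernoulli polynomials\<close>

definition bernoulli_egf :: "real fps" where
  "bernoulli_egf = Abs_fps (\<lambda>k. bernoulli_number k / fact k)"

text \<open>\<open>bernpoly_fact n u\<close> is \<open>B_n(u) / n!\<close>; normalised so that each is the derivative of the next.\<close>

definition bernpoly_fact :: "nat \<Rightarrow> real \<Rightarrow> real" where
  "bernpoly_fact n u = fps_nth (bernoulli_egf * fps_exp u) n"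

lemma bernoulli_egf_mult: "bernoulli_egf * (fps_exp 1 - 1) = fps_X"
  unfolding bernoulli_egf_def by (rule bernoulli_number_egf)

lemma bernoulli_egf_mult_exp: "bernoulli_egf * fps_exp 1 = bernoulli_egf + fps_X"
  using bernoulli_egf_mult by (simp add: algebra_simps)

lemma fps_exp_compose_uminus: "fps_exp (c::real) oo - fps_X = fps_exp (- c)"
  by (simp add: fps_compose_uminus' fps_eq_iff power_minus[of c] mult_ac)

text \<open>Substitute -z for z in the defining product, multiply by e^z and cancel e^z - 1. This is
  the source of the reflection symmetry u -> 1 - u.\<close>

lemma bernoulli_egf_uminus: "bernoulli_egf oo - fps_X = bernoulli_egf * fps_exp 1"
proof -
  let ?C = "bernoulli_egf oo - fps_X"
  have "(bernoulli_egf * (fps_exp 1 - 1)) oo - fps_X = fps_X oo - (fps_X :: real fps)"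
    by (simp only: bernoulli_egf_mult)
  then have "?C * (fps_exp (- 1) - 1) = - fps_X"
    by (simp add: fps_compose_mult_distrib fps_compose_sub_distrib fps_exp_compose_uminus)
  then have "?C * (fps_exp (- 1) * fps_exp 1) - ?C * fps_exp 1 = - fps_X * fps_exp 1"
    by (metis left_diff_distrib mult.assoc mult_1 right_diff_distrib)
  then have "?C * (fps_exp 1 - 1) = fps_X * fps_exp 1"
    by (simp add: algebra_simps flip: fps_exp_add_mult)
  also have "\<dots> = (bernoulli_egf * fps_exp 1) * (fps_exp 1 - 1)"
    by (simp add: mult_ac flip: bernoulli_egf_mult)
  finally have "?C * (fps_exp 1 - 1) = (bernoulli_egf * fps_exp 1) * (fps_exp 1 - 1)" .
  moreover have "fps_exp (1::real) - 1 \<noteq> 0"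
    using bernoulli_egf_mult by auto
  ultimately show ?thesis
    by simp
qed

lemma bernpoly_fact_altdef:
  "bernpoly_fact n u = (\<Sum>i=0..n. fps_nth bernoulli_egf i * (u ^ (n - i) / fact (n - i)))"
  by (simp add: bernpoly_fact_def fps_mult_nth)

lemma bernpoly_fact_at_0: "bernpoly_fact n 0 = bernoulli_number n / fact n"
  by (simp add: bernpoly_fact_def bernoulli_egf_def)

text \<open>Since e^((1-u)z) = e^z e^(-uz), the factor e^z is absorbed by
  \<open>bernoulli_egf_uminus\<close>; what remains is the generating function at -z, whose n-th
  coefficient carries the factor (-1)^n.\<close>

lemma bernpoly_fact_reflect: "bernpoly_fact n (1 - u) = (- 1) ^ n * bernpoly_fact n u"
proof -
  have "bernoulli_egf * fps_exp (1 - u) = bernoulli_egf * fps_exp 1 * fps_exp (- u)"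
    using fps_exp_add_mult[of 1 "- u"] by (simp add: mult_ac)
  also have "\<dots> = (bernoulli_egf * fps_exp u) oo - fps_X"
    by (simp add: fps_compose_mult_distrib fps_exp_compose_uminus bernoulli_egf_uminus)
  finally show ?thesis
    by (simp add: bernpoly_fact_def fps_compose_uminus')
qed

lemma bernpoly_fact_at_1:
  "bernpoly_fact n 1 = bernoulli_number n / fact n + (if n = 1 then 1 else 0)"
  unfolding bernpoly_fact_def bernoulli_egf_mult_exp by (simp add: bernoulli_egf_def)

lemma bernoulli_number_0: "bernoulli_number 0 = 1"
  using arg_cong[OF bernoulli_egf_mult, of "\<lambda>f. fps_nth f 1"]
  by (simp add: fps_mult_nth bernoulli_egf_def)

lemma bernoulli_number_1: "bernoulli_number 1 = - 1 / 2"
  using bernpoly_fact_reflect[of 1 0] by (simp add: bernpoly_fact_at_0 bernpoly_fact_at_1)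

text \<open>For these n the values at 0 and 1 agree, while reflection makes them opposite.\<close>

lemma bernoulli_number_odd:
  assumes "odd n" "n \<noteq> 1"
  shows "bernoulli_number n = 0"
  using bernpoly_fact_reflect[of n 0] assms
  by (simp add: bernpoly_fact_at_0 bernpoly_fact_at_1)

lemma bernpoly_fact_odd_half: "odd n \<Longrightarrow> bernpoly_fact n (1/2) = 0"
  using bernpoly_fact_reflect[of n "1/2"] by simp

lemma bernpoly_fact_0: "bernpoly_fact 0 u = 1"
  by (simp add: bernpoly_fact_altdef bernoulli_egf_def bernoulli_number_0)

lemma bernpoly_fact_1: "bernpoly_fact 1 u = u - 1 / 2"
  using bernoulli_number_1
  by (simp add: bernpoly_fact_altdef bernoulli_egf_def bernoulli_number_0)

lemma DERIV_add_const:
  "(f has_real_derivative D) F \<Longrightarrow> ((\<lambda>u. f u + c) has_real_derivative D) F"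
  by (auto intro!: derivative_eq_intros)

lemma DERIV_bernpoly_fact:
  "(bernpoly_fact (Suc n) has_real_derivative bernpoly_fact n u) (at u)"
proof -
  have "((\<lambda>u. \<Sum>i=0..n. fps_nth bernoulli_egf i * (u ^ Suc (n - i) / fact (Suc (n - i))))
      has_real_derivative bernpoly_fact n u) (at u)"
    unfolding bernpoly_fact_altdef
  proof (rule DERIV_sum, rule DERIV_cmult)
    fix i
    show "((\<lambda>u. u ^ Suc (n - i) / fact (Suc (n - i))) has_real_derivative
        u ^ (n - i) / fact (n - i)) (at u)"
      using DERIV_cdivide[OF DERIV_pow[of "Suc (n - i)" u], of "fact (Suc (n - i))"]
      by (simp del: power_Suc of_nat_Suc)
  qed
  \<comment> \<open>The summand with index \<open>Suc n\<close> does not depend on u, so it is split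
    off as a constant.\<close>
  moreover have "bernpoly_fact (Suc n) = (\<lambda>u. (\<Sum>i=0..n. fps_nth bernoulli_egf i *
      (u ^ Suc (n - i) / fact (Suc (n - i)))) + fps_nth bernoulli_egf (Suc n))"
    unfolding bernpoly_fact_altdef sum.atLeast0_atMost_Suc
    by (intro ext arg_cong2[of _ _ _ _ "(+)"] sum.cong) (auto simp: Suc_diff_le)
  ultimately show ?thesis
    by (simp only: DERIV_add_const)
qed

lemma continuous_on_bernpoly_fact: "continuous_on S (bernpoly_fact n)"
proof -
  have eq: "bernpoly_fact n =
    (\<lambda>u. \<Sum>i=0..n. fps_nth bernoulli_egf i * (u ^ (n - i) / fact (n - i)))"
    by (rule ext) (rule bernpoly_fact_altdef)
  show ?thesis
    unfolding eq by (intro continuous_intros) auto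
qed

section \<open>Signs of the Bernoulli polynomials\<close>

lemma strict_convex_neg:
  fixes h h' h'' :: "real \<Rightarrow> real"
  assumes h: "\<And>u. (h has_real_derivative h' u) (at u)"
    and h': "\<And>u. (h' has_real_derivative h'' u) (at u)"
    and pos: "\<And>u. a < u \<Longrightarrow> u < b \<Longrightarrow> h'' u > 0"
    and ends: "h a = 0" "h b = 0"
    and u: "a < u" "u < b"
  shows "h u < 0"
proof (rule ccontr)
  assume neg: "\<not> h u < 0"
  \<comment> \<open>If \<open>h u\<close> were nonnegative, the mean value theorem would give a
    slope \<ge> 0 left of u and one \<le> 0 right of u, although \<open>h'\<close> is strictly
    increasing.\<close>
  obtain v where v: "a < v" "v < u" "h u - h a = (u - a) * h' v"
    using MVT2[OF \<open>a < u\<close>, of h h'] h by blast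
  obtain w where w: "u < w" "w < b" "h b - h u = (b - u) * h' w"
    using MVT2[OF \<open>u < b\<close>, of h h'] h by blast
  have "h' v \<ge> 0"
    using neg v ends u by (simp add: zero_le_mult_iff not_less)
  moreover have "(b - u) * h' w \<le> 0"
    using neg w ends by simp
  then have "h' w \<le> 0"
    using u by (simp add: mult_le_0_iff)
  moreover have "h' v < h' w"
  proof (rule DERIV_pos_imp_increasing[where f = h'])
    show "v < w" using v w by simp
    show "\<exists>y. (h' has_real_derivative y) (at t) \<and> 0 < y" if "v \<le> t" "t \<le> w" for t
      using h'[of t] pos[of t] that v w by (intro exI[of _ "h'' t"]) simp
  qed
  ultimately show False by simp
qed

text \<open>
  A Bernoulli polynomial of odd degree at least 3 vanishes at 0 and 1/2, and its second derivative is a multiple of the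
  preceding odd one; so the signs alternate by convexity.
\<close>

lemma bernpoly_fact_odd_sign:
  assumes "0 < u" "u < 1 / 2"
  shows "(- 1) ^ Suc M * bernpoly_fact (2 * M + 1) u > 0"
  using assms
proof (induction M arbitrary: u)
  case 0
  then show ?case using bernpoly_fact_1[of u] by simp
next
  case (Suc M)
  define s :: real where "s = (- 1) ^ Suc M"
  have "s * bernpoly_fact (2 * Suc M + 1) u < 0"
  proof (rule strict_convex_neg[of "\<lambda>u. s * bernpoly_fact (2 * Suc M + 1) u"
        "\<lambda>u. s * bernpoly_fact (2 * M + 2) u"
        "\<lambda>u. s * bernpoly_fact (2 * M + 1) u" 0 "1 / 2"])
    show "((\<lambda>u. s * bernpoly_fact (2 * Suc M + 1) u) has_real_derivative
        s * bernpoly_fact (2 * M + 2) u) (at u)" for u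
      using DERIV_bernpoly_fact[of "2 * M + 2" u] by (intro DERIV_cmult) simp
    show "((\<lambda>u. s * bernpoly_fact (2 * M + 2) u) has_real_derivative
        s * bernpoly_fact (2 * M + 1) u) (at u)" for u
      using DERIV_bernpoly_fact[of "2 * M + 1" u] by (intro DERIV_cmult) simp
    show "0 < s * bernpoly_fact (2 * M + 1) u" if "0 < u" "u < 1 / 2" for u
      unfolding s_def using that by (rule Suc.IH)
    show "s * bernpoly_fact (2 * Suc M + 1) 0 = 0"
      by (simp add: bernpoly_fact_at_0 bernoulli_number_odd)
    show "s * bernpoly_fact (2 * Suc M + 1) (1 / 2) = 0"
      by (simp add: bernpoly_fact_odd_half)
  qed (use Suc.prems in auto)
  then show ?case by (simp add: s_def)
qed

text \<open>The subtracted constant is the value at 0. By \<open>bernpoly_fact_odd_sign\<close> the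
  derivative has constant sign on (0, 1/2), so the polynomial moves strictly away from that value;
  reflection covers the other half.\<close>

lemma bernpoly_fact_even_sign:
  assumes "0 < u" "u < 1"
  shows "(- 1) ^ Suc M *
    (bernpoly_fact (2 * M + 2) u - bernoulli_number (2 * M + 2) / fact (2 * M + 2)) > 0"
proof -
  define s :: real where "s = (- 1) ^ Suc M"
  define h where "h = (\<lambda>u. s * bernpoly_fact (2 * M + 2) u)"
  have half: "h 0 < h u" if "0 < u" "u \<le> 1 / 2" for u
  proof (rule DERIV_pos_imp_increasing_open[OF that(1)])
    fix v assume "0 < v" "v < u"
    moreover have "(h has_real_derivative s * bernpoly_fact (2 * M + 1) v) (at v)"
      using DERIV_bernpoly_fact[of "2 * M + 1" v] unfolding h_def by (intro DERIV_cmult) simp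
    ultimately show "\<exists>y. (h has_real_derivative y) (at v) \<and> 0 < y"
      using bernpoly_fact_odd_sign[of v M] that by (auto simp: s_def)
  qed (simp add: h_def continuous_on_mult_left continuous_on_bernpoly_fact)
  have "h 0 < h u"
  proof (cases "u \<le> 1 / 2")
    case False
    have "h u = h (1 - u)"
      using bernpoly_fact_reflect[of "2 * M + 2" u] by (simp add: h_def)
    then show ?thesis using half[of "1 - u"] False assms by simp
  qed (use assms half in simp)
  then show ?thesis
    by (simp add: h_def s_def bernpoly_fact_at_0 right_diff_distrib)
qed

section \<open>Euler--Maclaurin summation of the logarithm\<close>

text \<open>The k-th derivative of \<open>ln\<close> at positive arguments; the closed form starts
  at k = 1.\<close>

definition ln_nderiv :: "nat \<Rightarrow> real \<Rightarrow> real" where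
  "ln_nderiv k y = (if k = 0 then ln y else (- 1) ^ (k - 1) * fact (k - 1) / y ^ k)"

lemma DERIV_ln_nderiv:
  assumes "y > 0"
  shows "(ln_nderiv k has_real_derivative ln_nderiv (Suc k) y) (at y)"
proof (cases k)
  case 0
  then show ?thesis
    using assms by (auto simp: ln_nderiv_def[abs_def] divide_inverse intro!: DERIV_ln)
next
  case (Suc l)
  have "((\<lambda>y. (- 1) ^ l * fact l / y ^ Suc l) has_real_derivative
      (- 1) ^ Suc l * fact (Suc l) / y ^ Suc (Suc l)) (at y)"
    using DERIV_cmult[OF DERIV_power_Suc[OF DERIV_inverse[of y UNIV]], of "(- 1) ^ l * fact l" l] assms
    by (simp add: divide_inverse power_inverse algebra_simps)
  then show ?thesis
    using Suc by (simp add: ln_nderiv_def[abs_def])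
qed

text \<open>The sum telescopes under differentiation, so no remainder integral is needed.\<close>

lemma DERIV_euler_maclaurin:
  assumes "x + u > 0"
  shows "((\<lambda>u. (x + u) * ln (x + u) - (x + u) +
      (\<Sum>k<n. (- 1) ^ Suc k * bernpoly_fact (Suc k) u * ln_nderiv k (x + u)))
    has_real_derivative (- 1) ^ n * bernpoly_fact n u * ln_nderiv n (x + u)) (at u)"
proof (induction n)
  case 0
  then show ?case
    using assms by (auto intro!: derivative_eq_intros simp: bernpoly_fact_0 ln_nderiv_def)
next
  case (Suc n)
  have D: "((\<lambda>u. ln_nderiv n (x + u)) has_real_derivative ln_nderiv (Suc n) (x + u)) (at u)"
    using iffD1[OF DERIV_shift DERIV_ln_nderiv[of "u + x" n]] assms by (simp add: add.commute)
  have "((\<lambda>u. (- 1) ^ Suc n * (bernpoly_fact (Suc n) u * ln_nderiv n (x + u)))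
      has_real_derivative (- 1) ^ Suc n * (bernpoly_fact n u * ln_nderiv n (x + u)
        + ln_nderiv (Suc n) (x + u) * bernpoly_fact (Suc n) u)) (at u)"
    by (intro DERIV_cmult DERIV_mult DERIV_bernpoly_fact D)
  from DERIV_add[OF Suc.IH this] show ?case
    by (simp add: algebra_simps)
qed

text \<open>Degree 1 takes the values -1/2 and 1/2 at the ends and gives the trapezoidal term. Odd
  degrees from 3 on vanish there, and even degrees take the same value at both ends, so only
  differences of derivatives remain.\<close>

lemma euler_maclaurin_boundary:
  "(\<Sum>k<2 * M + 2. (- 1) ^ Suc k * bernpoly_fact (Suc k) 1 * ln_nderiv k (x + 1))
    - (\<Sum>k<2 * M + 2. (- 1) ^ Suc k * bernpoly_fact (Suc k) 0 * ln_nderiv k x)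
   = - (ln (x + 1) + ln x) / 2 + (\<Sum>j=1..Suc M. bernoulli_number (2 * j) / fact (2 * j)
       * (ln_nderiv (2 * j - 1) (x + 1) - ln_nderiv (2 * j - 1) x))"
proof (induction M)
  case 0
  have "bernpoly_fact (Suc 0) 1 = 1 / 2" "bernpoly_fact (Suc 0) 0 = - 1 / 2"
    using bernpoly_fact_1 by simp_all
  then show ?case
    by (simp add: numeral_2_eq_2 bernpoly_fact_at_0 bernpoly_fact_at_1[of "Suc (Suc _)"]
        ln_nderiv_def[of 0] right_diff_distrib)
next
  case (Suc M)
  define f where "f = (\<lambda>v y k. (- 1) ^ Suc k * bernpoly_fact (Suc k) v * ln_nderiv k y)"
  define c where "c = bernoulli_number (2 * M + 4) / fact (2 * M + 4)"
  \<comment> \<open>Passing to \<open>Suc M\<close> appends two indices: k = 2M+2, of odd degree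
    2M+3, which vanishes, and k = 2M+3, which yields the new summand.\<close>
  have zero: "f v y (2 * M + 2) = 0" if "v = 0 \<or> v = 1" for v y
  proof -
    have "bernoulli_number (2 * M + 3) = 0"
      by (rule bernoulli_number_odd) simp_all
    then show ?thesis
      using that by (auto simp: f_def bernpoly_fact_at_0 bernpoly_fact_at_1 eval_nat_numeral)
  qed
  have next_term: "f v y (2 * M + 3) = c * ln_nderiv (2 * M + 3) y" if "v = 0 \<or> v = 1" for v y
  proof -
    have "(- 1 :: real) ^ Suc (2 * M + 3) = 1"
      by simp
    moreover have "bernpoly_fact (Suc (2 * M + 3)) v = c"
      using that by (auto simp: c_def bernpoly_fact_at_0 bernpoly_fact_at_1 eval_nat_numeral)
    ultimately show ?thesis
      unfolding f_def by simp
  qed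
  have split: "(\<Sum>k<2 * Suc M + 2. f v y k) = (\<Sum>k<2 * M + 2. f v y k) + c * ln_nderiv (2 * M + 3) y"
    if "v = 0 \<or> v = 1" for v y
    using zero[OF that, of y] next_term[OF that, of y] by (simp add: eval_nat_numeral)
  have "(\<Sum>j=1..Suc (Suc M). bernoulli_number (2 * j) / fact (2 * j)
       * (ln_nderiv (2 * j - 1) (x + 1) - ln_nderiv (2 * j - 1) x))
     = (\<Sum>j=1..Suc M. bernoulli_number (2 * j) / fact (2 * j)
       * (ln_nderiv (2 * j - 1) (x + 1) - ln_nderiv (2 * j - 1) x))
     + c * (ln_nderiv (2 * M + 3) (x + 1) - ln_nderiv (2 * M + 3) x)"
    by (subst sum.cl_ivl_Suc) (simp add: c_def eval_nat_numeral)
  with Suc split[of 1 "x + 1"] split[of 0 x] show ?case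
    unfolding f_def by (simp add: right_diff_distrib)
qed

section \<open>The remainder of Stirling's series\<close>

definition stirling_sum :: "nat \<Rightarrow> real \<Rightarrow> real" where
  "stirling_sum M y =
     (\<Sum>j=1..M. bernoulli_number (2 * j) / ((2 * real j - 1) * (2 * real j)) / y ^ (2 * j - 1))"

definition stirling_rem :: "nat \<Rightarrow> nat \<Rightarrow> real" where
  "stirling_rem M n =
     ln (fact n) - (real n * ln n - real n + ln (2 * pi * real n) / 2) - stirling_sum M n"

text \<open>Identifies the Euler--Maclaurin boundary terms with the terms of Stirling's series:
  (2j)! = 2j (2j-1) (2j-2)!, and derivatives of \<open>ln\<close> of odd order are positive for y >
  0.\<close>

lemma bernoulli_ln_nderiv_eq:
  assumes "j \<ge> 1"
  shows "bernoulli_number (2 * j) / fact (2 * j) * ln_nderiv (2 * j - 1) y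
    = bernoulli_number (2 * j) / ((2 * real j - 1) * (2 * real j)) / y ^ (2 * j - 1)"
proof -
  obtain i where i: "j = Suc i" using assms by (cases j) auto
  have fact: "fact (2 * j) = (2 * real j - 1) * (2 * real j) * fact (2 * i)"
    by (simp add: i algebra_simps)
  have "ln_nderiv (2 * j - 1) y = fact (2 * i) / y ^ (2 * j - 1)"
    by (simp add: i ln_nderiv_def)
  then show ?thesis
    unfolding fact by simp
qed

lemma sum_bernoulli_ln_nderiv:
  "(\<Sum>j=1..M. bernoulli_number (2 * j) / fact (2 * j)
       * (ln_nderiv (2 * j - 1) (x + 1) - ln_nderiv (2 * j - 1) x))
    = stirling_sum M (x + 1) - stirling_sum M x"
  unfolding stirling_sum_def sum_subtractf[symmetric] right_diff_distrib
  by (intro sum.cong refl) (subst (1 2) bernoulli_ln_nderiv_eq; simp)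

text \<open>At x = n the bracket is the drop of the remainder from n to n + 1. It is the increment
  over [0,1] of a function whose derivative is a product of two factors of constant sign: the
  shifted Bernoulli polynomial and a derivative of \<open>ln\<close> of even order, which is
  negative.\<close>

lemma stirling_step_sign:
  assumes "x > 0"
  shows "(- 1) ^ M * ((x + 1 / 2) * (ln (x + 1) - ln x) - 1
      - (stirling_sum M x - stirling_sum M (x + 1))) > 0"
proof -
  define s :: real where "s = (- 1) ^ M"
  define b where "b = bernoulli_number (2 * M + 2) / fact (2 * M + 2)"
  define H where "H = (\<lambda>u. (x + u) * ln (x + u) - (x + u) +
      (\<Sum>k<2 * M + 2. (- 1) ^ Suc k * bernpoly_fact (Suc k) u * ln_nderiv k (x + u)))"
  \<comment> \<open>The correction by \<open>b\<close> replaces \<open>B_{2M+2}(u)\<close> by \<open>B_{2M+2}(u) - B_{2M+2}\<close> in the derivative.\<close>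
  define F where "F = (\<lambda>u. s * (H u - b * ln_nderiv (2 * M + 1) (x + u)))"
  have dF: "(F has_real_derivative
      s * ((bernpoly_fact (2 * M + 2) u - b) * ln_nderiv (2 * M + 2) (x + u))) (at u)"
    if "u \<ge> 0" for u
  proof -
    have pos: "x + u > 0" using assms that by simp
    have D: "((\<lambda>u. ln_nderiv (2 * M + 1) (x + u)) has_real_derivative
        ln_nderiv (2 * M + 2) (x + u)) (at u)"
      using iffD1[OF DERIV_shift DERIV_ln_nderiv[of "u + x" "2 * M + 1"]] pos
      by (simp add: add.commute)
    have "(H has_real_derivative
        bernpoly_fact (2 * M + 2) u * ln_nderiv (2 * M + 2) (x + u)) (at u)"
      using DERIV_euler_maclaurin[OF pos, of "2 * M + 2"] by (simp add: H_def)
    then have "(F has_real_derivative s * (bernpoly_fact (2 * M + 2) u * ln_nderiv (2 * M + 2) (x + u)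
        - b * ln_nderiv (2 * M + 2) (x + u))) (at u)"
      unfolding F_def by (intro DERIV_cmult DERIV_diff D)
    then show ?thesis by (simp add: left_diff_distrib)
  qed
  have "F 0 < F 1"
  proof (rule DERIV_pos_imp_increasing_open[of 0 1 F])
    fix u :: real assume u: "0 < u" "u < 1"
    have "s * (bernpoly_fact (2 * M + 2) u - b) < 0"
      using bernpoly_fact_even_sign[OF u, of M] by (simp add: s_def b_def)
    moreover have "ln_nderiv (2 * M + 2) (x + u) < 0"
      using assms u by (simp add: ln_nderiv_def)
    ultimately show "\<exists>y. (F has_real_derivative y) (at u) \<and> 0 < y"
      using dF[of u] u mult_neg_neg by (fastforce simp: mult.assoc)
  next
    show "continuous_on {0..1} F"
      by (intro continuous_at_imp_continuous_on ballI DERIV_isCont[OF dF]) simp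
  qed simp
  \<comment> \<open>The boundary sum runs to j = M + 1; the correction by \<open>b\<close> cancels
    its last term and leaves exactly \<open>stirling_sum M\<close>.\<close>
  moreover have "H 1 - H 0 - b * (ln_nderiv (2 * M + 1) (x + 1) - ln_nderiv (2 * M + 1) x)
    = (x + 1 / 2) * (ln (x + 1) - ln x) - 1 - (stirling_sum M x - stirling_sum M (x + 1))"
  proof -
    have "(\<Sum>j=1..Suc M. bernoulli_number (2 * j) / fact (2 * j)
        * (ln_nderiv (2 * j - 1) (x + 1) - ln_nderiv (2 * j - 1) x))
      = stirling_sum M (x + 1) - stirling_sum M x
        + b * (ln_nderiv (2 * M + 1) (x + 1) - ln_nderiv (2 * M + 1) x)"
      unfolding sum_bernoulli_ln_nderiv[symmetric] by (subst sum.cl_ivl_Suc) (simp add: b_def)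
    moreover have "H 1 = (x + 1) * ln (x + 1) - (x + 1) +
        (\<Sum>k<2 * M + 2. (- 1) ^ Suc k * bernpoly_fact (Suc k) 1 * ln_nderiv k (x + 1))"
      by (simp only: H_def)
    moreover have "H 0 = x * ln x - x +
        (\<Sum>k<2 * M + 2. (- 1) ^ Suc k * bernpoly_fact (Suc k) 0 * ln_nderiv k x)"
      by (simp only: H_def add_0_right)
    ultimately have "H 1 - H 0 = (x + 1) * ln (x + 1) - x * ln x - 1 - (ln (x + 1) + ln x) / 2
        + (stirling_sum M (x + 1) - stirling_sum M x)
        + b * (ln_nderiv (2 * M + 1) (x + 1) - ln_nderiv (2 * M + 1) x)"
      using euler_maclaurin_boundary[where M = M and x = x] by linarith
    then show ?thesis
      by (simp add: algebra_simps) (simp add: field_simps)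
  qed
  moreover have "F 1 - F 0 =
      s * (H 1 - H 0 - b * (ln_nderiv (2 * M + 1) (x + 1) - ln_nderiv (2 * M + 1) x))"
    by (simp add: F_def algebra_simps)
  ultimately show ?thesis unfolding s_def by simp
qed

text \<open>The quotient of consecutive factorials is n + 1 and the constant ln(2 pi)/2 cancels, so
  the difference is the bracket of \<open>stirling_step_sign\<close>. The constant itself is
  confirmed only by the limit of the remainder.\<close>

lemma stirling_rem_Suc_less:
  assumes "n > 0"
  shows "(- 1) ^ M * stirling_rem M (Suc n) < (- 1) ^ M * stirling_rem M n"
proof -
  have ln2: "ln (2 * pi * real k) = ln (2 * pi) + ln (real k)" if "k > 0" for k
    using that by (simp add: ln_mult)
  have "ln (fact (Suc n)) = ln (real n + 1) + ln (fact n)"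
    by (simp add: ln_mult add.commute)
  then have "stirling_rem M n - stirling_rem M (Suc n)
    = (real n + 1 / 2) * (ln (real n + 1) - ln (real n)) - 1
      - (stirling_sum M (real n) - stirling_sum M (real n + 1))"
    using assms ln2[of n] ln2[of "Suc n"]
    by (simp add: stirling_rem_def field_simps)
  then have "(- 1) ^ M * (stirling_rem M n - stirling_rem M (Suc n)) > 0"
    using stirling_step_sign[of "real n" M] assms by simp
  then show ?thesis by (simp add: right_diff_distrib)
qed

lemma stirling_rem_decreasing:
  assumes "0 < m" "m < n"
  shows "(- 1) ^ M * stirling_rem M n < (- 1) ^ M * stirling_rem M m"
  using assms(2)
proof (induction n)
  case (Suc n)
  show ?case
  proof (cases "m = n")
    case False
    with Suc have "(- 1) ^ M * stirling_rem M n < (- 1) ^ M * stirling_rem M m" by simp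
    then show ?thesis
      using stirling_rem_Suc_less[of n M] assms(1) Suc.prems by linarith
  qed (use stirling_rem_Suc_less assms(1) in simp)
qed simp

section \<open>Wallis' product and the limit of the remainder\<close>

lemma wallis_product_fact:
  "(\<Prod>k=1..n. (4 * real k ^ 2) / (4 * real k ^ 2 - 1)) * (fact (2 * n) ^ 2 * (2 * real n + 1))
    = 16 ^ n * fact n ^ 4"
proof (induction n)
  case (Suc n)
  let ?W = "\<lambda>n. \<Prod>k=1..n. (4 * real k ^ 2) / (4 * real k ^ 2 - 1)"
  have fac: "4 * real (Suc n) ^ 2 - 1 = (2 * real n + 1) * (2 * real n + 3)"
    by (simp add: power2_eq_square algebra_simps)
  have fact2: "fact (2 * Suc n) = (2 * real n + 2) * (2 * real n + 1) * fact (2 * n)"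
    by (simp add: algebra_simps)
  have "?W (Suc n) * (fact (2 * Suc n) ^ 2 * (2 * real (Suc n) + 1))
    = ?W n * (4 * real (Suc n) ^ 2 / ((2 * real n + 1) * (2 * real n + 3)))
       * (((2 * real n + 2) * (2 * real n + 1) * fact (2 * n)) ^ 2 * (2 * real n + 3))"
    unfolding fact2 by (simp add: fac[symmetric])
  also have "\<dots> = (?W n * (fact (2 * n) ^ 2 * (2 * real n + 1)))
       * (4 * real (Suc n) ^ 2 * (2 * real n + 2) ^ 2)"
  proof -
    \<comment> \<open>Applied with a = 2n+1, b = 2n+3, z = 2n+2, f = (2n)! and w the product up to
      n.\<close>
    have *: "w * (y / (a * b)) * ((z * a * f) ^ 2 * b) = w * (f ^ 2 * a) * (y * z ^ 2)"
      if "a \<noteq> 0" "b \<noteq> 0" for w y z a b f :: real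
      using that by (simp add: power2_eq_square)
    show ?thesis by (rule *) (simp_all add: add_nonneg_eq_0_iff)
  qed
  also note Suc.IH
  also have "2 * real n + 2 = 2 * real (Suc n)"
    by simp
  also have "16 ^ n * fact n ^ 4 * (4 * real (Suc n) ^ 2 * (2 * real (Suc n)) ^ 2)
      = 16 ^ Suc n * (real (Suc n) * fact n) ^ 4"
    by (simp only: power_mult_distrib) (simp add: power_numeral_reduce del: of_nat_Suc)
  finally have "?W (Suc n) * (fact (2 * Suc n) ^ 2 * (2 * real (Suc n) + 1))
      = 16 ^ Suc n * (real (Suc n) * fact n) ^ 4" .
  then show ?case by simp
qed simp

text \<open>The weights 4 and -2 are the exponents of n! and 1/(2n)! in Wallis' product. With them
  the n ln n and linear terms of Stirling's formula reduce to 4 n ln 2, which matches the factor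
  16^n.\<close>

lemma stirling_rem_0_wallis:
  assumes "n > 0"
  shows "4 * stirling_rem 0 n - 2 * stirling_rem 0 (2 * n)
    = ln (\<Prod>k=1..n. (4 * real k ^ 2) / (4 * real k ^ 2 - 1)) - ln (pi * real n / (2 * real n + 1))"
proof -
  define W where "W = (\<Prod>k=1..n. (4 * real k ^ 2) / (4 * real k ^ 2 - 1))"
  have "4 * real k ^ 2 - 1 > 0" if "k \<ge> 1" for k
  proof -
    have "1 \<le> real k ^ 2" using that by (intro one_le_power) simp
    then show ?thesis by linarith
  qed
  then have W: "W > 0"
    unfolding W_def by (intro prod_pos) auto
  have "ln (W * (fact (2 * n) ^ 2 * (2 * real n + 1))) = ln (16 ^ n * fact n ^ 4)"
    unfolding W_def wallis_product_fact ..
  moreover have "ln (16 :: real) = 4 * ln 2"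
    using ln_realpow[of "2 :: real" 4] by simp
  ultimately have "ln W + 2 * ln (fact (2 * n)) + ln (2 * real n + 1) = 4 * real n * ln 2 + 4 * ln (fact n)"
    using W by (simp add: ln_mult ln_realpow)
  then show ?thesis
    using assms ln_realpow[of "2 :: real" 2] unfolding W_def[symmetric]
    by (simp add: stirling_rem_def stirling_sum_def ln_mult ln_div algebra_simps add_divide_distrib)
qed

lemma stirling_sum_tendsto_0: "(\<lambda>n. stirling_sum M (real n)) \<longlonglongrightarrow> 0"
proof -
  have lim: "(\<lambda>n. c / real n ^ (2 * j - 1)) \<longlonglongrightarrow> 0" if "j \<ge> 1" for c :: real and j
    by (rule tendsto_divide_0[OF tendsto_const])
       (use that in \<open>auto intro!: filterlim_at_top_imp_at_infinity filterlim_pow_at_top filterlim_real_sequentially\<close>)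
  then show ?thesis
    unfolding stirling_sum_def by (intro tendsto_null_sum lim) simp
qed

text \<open>
  The remainder is monotone and bounded, hence convergent to some \<open>l\<close>; Wallis' product gives
  \<open>4 l - 2 l = 0\<close>.
\<close>

lemma stirling_rem_0_tendsto_0: "stirling_rem 0 \<longlonglongrightarrow> 0"
proof -
  define c where "c = bernoulli_number 2 / 2"
  have rem: "stirling_rem 0 n = stirling_rem 1 n + c / real n" for n
    by (simp add: stirling_rem_def stirling_sum_def c_def)
  have dec: "decseq (\<lambda>n. stirling_rem 0 (Suc n))"
    using stirling_rem_Suc_less[of "Suc _" 0] by (intro decseq_SucI) (simp add: less_imp_le)
  \<comment> \<open>The remainder for M = 1 moves in the opposite direction and differs from that
    for M = 0 by c/n only, so its first value supplies the lower bound.\<close>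
  have inc: "incseq (\<lambda>n. stirling_rem 1 (Suc n))"
    using stirling_rem_Suc_less[of "Suc _" 1] by (intro incseq_SucI) (simp add: less_imp_le)
  have bound: "stirling_rem 1 1 - \<bar>c\<bar> \<le> stirling_rem 0 (Suc n)" for n
  proof -
    have "\<bar>c / real (Suc n)\<bar> \<le> \<bar>c\<bar>"
      by (simp add: field_simps mult_left_le)
    then have "- \<bar>c\<bar> \<le> c / real (Suc n)"
      by linarith
    then show ?thesis
      using incseqD[OF inc, of 0 n] unfolding rem One_nat_def by linarith
  qed
  obtain l where "(\<lambda>n. stirling_rem 0 (Suc n)) \<longlonglongrightarrow> l"
    using decseq_convergent[OF dec] bound by blast
  then have l: "stirling_rem 0 \<longlonglongrightarrow> l"
    by (simp add: filterlim_sequentially_Suc)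
  moreover have "filterlim (\<lambda>n::nat. 2 * n) sequentially sequentially"
    by (rule filterlim_subseq) (simp add: strict_mono_def)
  then have "(\<lambda>n. stirling_rem 0 (2 * n)) \<longlonglongrightarrow> l"
    by (rule filterlim_compose[OF l])
  ultimately have "(\<lambda>n. 4 * stirling_rem 0 n - 2 * stirling_rem 0 (2 * n)) \<longlonglongrightarrow> 4 * l - 2 * l"
    by (intro tendsto_intros)
  moreover have "(\<lambda>n. 4 * stirling_rem 0 n - 2 * stirling_rem 0 (2 * n)) \<longlonglongrightarrow> 0"
  proof -
    have "(\<lambda>n. pi * (real n / (2 * real n + 1))) \<longlonglongrightarrow> pi * (1 / 2)"
      by (intro tendsto_mult_left) real_asymp
    then have "(\<lambda>n. ln (\<Prod>k=1..n. (4 * real k ^ 2) / (4 * real k ^ 2 - 1))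
        - ln (pi * real n / (2 * real n + 1))) \<longlonglongrightarrow> ln (pi / 2) - ln (pi / 2)"
      by (intro tendsto_diff tendsto_ln wallis) auto
    then show ?thesis
      by (subst tendsto_cong[OF eventually_mono[OF eventually_gt_at_top[of 0]]])
         (auto simp: stirling_rem_0_wallis)
  qed
  ultimately have "4 * l - 2 * l = 0"
    by (rule LIMSEQ_unique)
  then show ?thesis using l by simp
qed

lemma stirling_rem_tendsto_0: "stirling_rem M \<longlonglongrightarrow> 0"
proof -
  have "stirling_rem M = (\<lambda>n. stirling_rem 0 n - stirling_sum M (real n))"
    by (simp add: stirling_rem_def stirling_sum_def fun_eq_iff)
  then show ?thesis
    using tendsto_diff[OF stirling_rem_0_tendsto_0 stirling_sum_tendsto_0] by simp
qed

lemma stirling_rem_sign: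
  assumes "n > 0"
  shows "(- 1) ^ M * stirling_rem M n > 0"
proof -
  let ?f = "\<lambda>k. (- 1) ^ M * stirling_rem M (Suc k)"
  have "decseq ?f"
    using stirling_rem_Suc_less by (intro decseq_SucI less_imp_le) simp
  moreover have "?f \<longlonglongrightarrow> (- 1) ^ M * 0"
    by (intro tendsto_mult_left LIMSEQ_Suc stirling_rem_tendsto_0)
  \<comment> \<open>\<open>?f n\<close> is the value at n + 1; one further strict step down to it
    from n makes the inequality strict.\<close>
  ultimately have "(- 1) ^ M * 0 \<le> ?f n"
    by (rule decseq_ge)
  then show ?thesis
    using stirling_rem_Suc_less[OF assms, of M] by simp
qed

section \<open>The mean absolute deviation of the binomial distribution\<close>

text \<open>As Np is the integer m, the absolute value changes sign exactly at the index m. The sums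
  below and from m on both telescope, and each contributes \<open>t m\<close>.\<close>

lemma binomial_mean_abs_deviation:
  fixes p :: real
  assumes p: "p \<in> {0..1}" and m: "real N * p = real m" and "m \<le> N"
  shows "measure_pmf.expectation (binomial_pmf N p) (\<lambda>k. \<bar>real k - real N * p\<bar>)
    = 2 * (1 - p) * real m * real (N choose m) * p ^ m * (1 - p) ^ (N - m)"
proof -
  define w where "w k = real (N choose k) * p ^ k * (1 - p) ^ (N - k)" for k
  \<comment> \<open>\<open>w k * (k - N p)\<close> is a difference of consecutive \<open>t k\<close>, which vanish at both ends.\<close>
  define t where "t k = (1 - p) * real k * w k" for k
  have step: "w k * (real k - real m) = t k - t (Suc k)" if k: "k \<le> N" for k
  proof (cases "k = N")
    \<comment> \<open>At the last index the exponent cannot drop any further; here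
      \<open>t (Suc N)\<close> vanishes through its binomial coefficient.\<close>
    case True
    then show ?thesis by (simp add: t_def w_def m[symmetric] binomial_eq_0 algebra_simps)
  next
    case False
    then obtain d where d: "N - k = Suc d" "N - Suc k = d" using k False by (cases "N - k") auto
    have "(Suc k) * (N choose Suc k) = (N - k) * (N choose k)"
      using times_binomial_minus1_eq[of "Suc k" N] binomial_absorb_comp[of N k] by simp
    then have "real (Suc k) * real (N choose Suc k) = real (N - k) * real (N choose k)"
      by (simp only: flip: of_nat_mult)
    moreover have "real N - real k = real (N - k)"
      using k by (simp add: of_nat_diff)
    ultimately have "real (Suc k) * w (Suc k) * (1 - p) = (real N - real k) * p * w k"
      by (simp add: w_def d mult_ac)
    then show ?thesis
      by (simp add: t_def m[symmetric] algebra_simps)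
  qed
  have "(\<Sum>k\<le>N. w k * \<bar>real k - real m\<bar>)
    = (\<Sum>k<m. w k * \<bar>real k - real m\<bar>) + (\<Sum>k=m..<Suc N. w k * \<bar>real k - real m\<bar>)"
    unfolding lessThan_Suc_atMost[symmetric] lessThan_atLeast0
    using \<open>m \<le> N\<close> by (intro sum.atLeastLessThan_concat[symmetric]) simp_all
  also have "(\<Sum>k<m. w k * \<bar>real k - real m\<bar>) = (\<Sum>k<m. t (Suc k) - t k)"
  proof (rule sum.cong)
    fix k assume "k \<in> {..<m}"
    then show "w k * \<bar>real k - real m\<bar> = t (Suc k) - t k"
      using step[of k] \<open>m \<le> N\<close> by (simp add: algebra_simps)
  qed simp
  also have "\<dots> = t m"
    by (subst sum_lessThan_telescope) (simp add: t_def)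
  also have "(\<Sum>k=m..<Suc N. w k * \<bar>real k - real m\<bar>) = (\<Sum>k=m..<Suc N. - (t (Suc k) - t k))"
    using step by (intro sum.cong) auto
  also have "\<dots> = t m"
    unfolding sum_negf using \<open>m \<le> N\<close> by (subst sum_Suc_diff') (simp_all add: t_def w_def)
  finally have "(\<Sum>k\<le>N. w k * \<bar>real k - real m\<bar>) = 2 * t m"
    by simp
  then show ?thesis
    unfolding m expectation_binomial_pmf'[OF p] by (simp add: w_def t_def mult.assoc)
qed

text \<open>The powers p^m q^n cancel the terms k ln k of the three factorials, the linear terms
  cancel by N = m + n, and the square root together with 2 q m absorbs the terms ln(2 pi
  k)/2.\<close>

lemma ln_mean_abs_deviation_stirling:
  fixes p q :: real
  assumes "0 < m" "0 < n" "N = m + n" "p = real m / real N" "q = real n / real N"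
  shows "ln (2 * q * real m * real (N choose m) * p ^ m * q ^ n / sqrt (2 * real N * p * q / pi))
    = stirling_rem 0 N - stirling_rem 0 m - stirling_rem 0 n"
proof -
  have N: "N > 0" and p: "p > 0" and q: "q > 0" using assms by auto
  define C where "C = real (N choose m)"
  have C: "C = fact N / (fact m * fact n)" "C > 0"
    using binomial_fact[of m N, where ?'a = real] assms(3) by (simp_all add: C_def)
  have lnC: "ln C = ln (fact N) - ln (fact m) - ln (fact n)"
    unfolding C by (simp add: ln_div ln_mult)
  have lnp: "ln p = ln m - ln N" and lnq: "ln q = ln n - ln N"
    using assms N by (simp_all add: ln_div del: of_nat_add)
  have "ln (sqrt (2 * real N * p * q / pi)) = (ln 2 + ln N + ln p + ln q - ln pi) / 2"
    using N p q by (simp add: ln_sqrt ln_mult ln_div)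
  moreover have "ln (2 * q * real m * C * p ^ m * q ^ n)
      = ln 2 + ln q + ln m + ln C + real m * ln p + real n * ln q"
    using N p q C(2) assms(1) by (simp add: ln_mult ln_realpow)
  moreover have "2 * q * real m * C * p ^ m * q ^ n > 0" "sqrt (2 * real N * p * q / pi) > 0"
    using N p q C(2) assms(1) by simp_all
  ultimately have "ln (2 * q * real m * C * p ^ m * q ^ n / sqrt (2 * real N * p * q / pi))
      = (ln 2 + ln q + ln m + ln C + real m * ln p + real n * ln q)
        - (ln 2 + ln N + ln p + ln q - ln pi) / 2"
    by (simp only: ln_divide_pos)
  also have "\<dots> = stirling_rem 0 N - stirling_rem 0 m - stirling_rem 0 n"
  proof -
    have ln2: "ln (2 * pi * real k) = ln 2 + ln pi + ln (real k)" if "k > 0" for k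
      using that by (simp add: ln_mult)
    have NM: "real N * x = real m * x + real n * x" for x
      using assms(3) by (simp add: distrib_right)
    show ?thesis
      unfolding stirling_rem_def ln2[OF N] ln2[OF assms(1)] ln2[OF assms(2)] lnC lnp lnq
      using assms(3) NM[of "ln N"] by (simp add: stirling_sum_def field_simps)
  qed
  finally show ?thesis by (simp add: C_def)
qed

text \<open>For p = m/N the power p^(1-2j) divided by N^(2j-1) is m^(1-2j), and likewise for q and
  n. Each summand thus splits into the Stirling terms at N, m and n.\<close>

lemma T_sum_eq_stirling_sum:
  assumes "0 < m" "0 < n" "N = m + n" "p = real m / real N"
  shows "T_sum p N M = stirling_sum M N - stirling_sum M m - stirling_sum M n"
proof -
  have q: "1 - p = real n / real N" using assms by (simp add: field_simps)
  have pw: "(real k / real N) powi (1 - 2 * int j) / real N ^ (2 * j - 1) = 1 / real k ^ (2 * j - 1)"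
    if "j \<ge> 1" "k > 0" for j k
  proof -
    have "1 - 2 * int j = - int (2 * j - 1)" using that by simp
    then have "(real k / real N) powi (1 - 2 * int j) = inverse ((real k / real N) ^ (2 * j - 1))"
      by (simp only: power_int_minus power_int_of_nat)
    then show ?thesis
      using assms that by (simp add: power_divide)
  qed
  show ?thesis
    unfolding T_sum_def stirling_sum_def sum_subtractf[symmetric]
  proof (rule sum.cong[OF refl])
    fix j assume j: "j \<in> {1..M}"
    define c where "c = bernoulli_number (2 * j) / ((2 * real j - 1) * (2 * real j))"
    have "a_coeff p j / real N ^ (2 * j - 1) = c * (1 / real N ^ (2 * j - 1)
        - (real m / real N) powi (1 - 2 * int j) / real N ^ (2 * j - 1)
        - (real n / real N) powi (1 - 2 * int j) / real N ^ (2 * j - 1))"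
      unfolding a_coeff_def q by (simp add: c_def assms(4) diff_divide_distrib add_divide_distrib algebra_simps)
    also have "\<dots> = c / real N ^ (2 * j - 1) - c / real m ^ (2 * j - 1) - c / real n ^ (2 * j - 1)"
      using pw[of j m] pw[of j n] j assms by (simp add: right_diff_distrib)
    finally show "a_coeff p j / real N ^ (2 * j - 1) = bernoulli_number (2 * j) /
        ((2 * real j - 1) * (2 * real j)) / real N ^ (2 * j - 1)
      - bernoulli_number (2 * j) / ((2 * real j - 1) * (2 * real j)) / real m ^ (2 * j - 1)
      - bernoulli_number (2 * j) / ((2 * real j - 1) * (2 * real j)) / real n ^ (2 * j - 1)"
      unfolding c_def .
  qed
qed

section \<open>Alternating enclosure of the logarithm\<close>

theorem theorem5p5:
  fixes p q :: real and N :: nat and \<Omega> :: "'a measure" and X :: "'a \<Rightarrow> nat"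
  assumes "0 < p" and "p < 1" and "q = 1 - p"
    and "N > 0"
    and "real N * p \<in> \<int>" and "1 \<le> real N * p" and "real N * p \<le> real N - 1"
    and "prob_space \<Omega>"
    and "X \<in> measurable \<Omega> (count_space UNIV)"
    and "distr \<Omega> (count_space UNIV) X = measure_pmf (binomial_pmf N p)"
  shows
    "let E = prob_space.expectation \<Omega> (\<lambda>\<omega>. \<bar>real (X \<omega>) - real N * p\<bar>);
         S = sqrt (2 * real N * p * q / pi);
         L = ln (E / S)
     in (\<forall>M. (-1) ^ (M + 1) * (L - T_sum p N M) > 0 \<and>
             sgn (L - T_sum p N M) = sgn (a_coeff p (M + 1) / real N ^ (2 * M + 1))) \<and>
        (\<forall>M. min (T_sum p N M) (T_sum p N (M + 1)) < L \<and>
             L < max (T_sum p N M) (T_sum p N (M + 1))) \<and>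
        S * exp (a_coeff p 1 / real N) < E \<and>
        E < S * exp (a_coeff p 1 / real N + a_coeff p 2 / real N ^ 3)"
proof -
  define m where "m = nat \<lfloor>real N * p\<rfloor>"
  have m: "real N * p = real m"
    using assms(5,6) by (auto simp: m_def elim!: Ints_cases)
  define n where "n = N - m"
  have m_pos: "m > 0" and n_pos: "n > 0" and N: "N = m + n"
    using assms(6,7) unfolding m n_def by simp_all
  have p: "p = real m / real N"
    using m assms(4) by (simp add: eq_divide_eq mult.commute)
  have "q * real N = real n"
    using m N assms(3) by (simp add: left_diff_distrib mult.commute)
  then have q: "q = real n / real N"
    using assms(4) by (simp add: eq_divide_eq)
  define E where "E = prob_space.expectation \<Omega> (\<lambda>\<omega>. \<bar>real (X \<omega>) - real N * p\<bar>)"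
  define S where "S = sqrt (2 * real N * p * q / pi)"
  define L where "L = ln (E / S)"
  have "E = measure_pmf.expectation (binomial_pmf N p) (\<lambda>k. \<bar>real k - real N * p\<bar>)"
    unfolding E_def assms(10)[symmetric] by (rule integral_distr[symmetric, OF assms(9)]) simp
  also have "\<dots> = 2 * q * real m * real (N choose m) * p ^ m * q ^ n"
    using binomial_mean_abs_deviation[OF _ m] assms(1-3) by (simp add: N)
  finally have E: "E = 2 * q * real m * real (N choose m) * p ^ m * q ^ n" .
  have pos: "S > 0" "E > 0"
    using assms(1-4) m_pos N unfolding S_def E by simp_all
  have "L = stirling_rem 0 N - stirling_rem 0 m - stirling_rem 0 n"
    unfolding L_def S_def E by (rule ln_mean_abs_deviation_stirling[OF m_pos n_pos N p q])
  then have diff: "L - T_sum p N M = stirling_rem M N - stirling_rem M m - stirling_rem M n" for M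
    unfolding T_sum_eq_stirling_sum[OF m_pos n_pos N p]
    by (simp add: stirling_rem_def stirling_sum_def[of 0])
  have sign: "(- 1) ^ (M + 1) * (L - T_sum p N M) > 0" for M
    using stirling_rem_decreasing[of m N M] stirling_rem_sign[of n M] m_pos n_pos N
    unfolding diff by (simp add: right_diff_distrib)
  have step: "T_sum p N (M + 1) - T_sum p N M = a_coeff p (M + 1) / real N ^ (2 * M + 1)" for M
    by (simp add: T_sum_def)
  have cases: "T_sum p N M < L \<and> L < T_sum p N (M + 1) \<or>
      T_sum p N (M + 1) < L \<and> L < T_sum p N M" for M
    \<comment> \<open>The errors at M and M + 1 have opposite signs. Hence L lies on the same side
      of \<open>T_sum p N M\<close> as the next partial sum, which also gives the sign of the first
      omitted term.\<close>
    using sign[of M] sign[of "M + 1"] by (cases "even M") auto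
  have E_eq: "E = S * exp L"
    using pos by (simp add: L_def)
  have "sgn (L - T_sum p N M) = sgn (a_coeff p (M + 1) / real N ^ (2 * M + 1))" for M
    unfolding step[symmetric] using cases[of M] by (auto simp: sgn_if)
  moreover have "min (T_sum p N M) (T_sum p N (M + 1)) < L \<and>
      L < max (T_sum p N M) (T_sum p N (M + 1))" for M
    using cases[of M] by auto
  \<comment> \<open>M = 1 bounds L from below and M = 2 from above; exponentiating gives the two
    explicit bounds.\<close>
  moreover have "S * exp (a_coeff p 1 / real N) < E"
    using sign[of 1] pos by (simp add: E_eq T_sum_def)
  moreover have "E < S * exp (a_coeff p 1 / real N + a_coeff p 2 / real N ^ 3)"
    using sign[of 2] pos by (simp add: E_eq T_sum_def eval_nat_numeral)
  ultimately show ?thesis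
    unfolding Let_def E_def[symmetric] S_def[symmetric] L_def[symmetric]
    using sign by blast
qed

end
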